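(* Let $t>0$ and let $r$ be a rational function with no pole on $(-\infty,0]$; put $e_r(z)=e^{tz}-r(z)$. (1) For every matrix $A=A^*\le0$ and vector $b$, with $\mu_b(\Omega)=\langle E_A(\Omega)b,b\rangle$, where $E_A$ is the spectral resolution of $A$, $$\|e^{tA}b-r(A)b\|_2^2=\int_{\sigma(A)}|e_r(\lambda)|^2\,d\mu_b(\lambda).$$ (2) For every fixed dimension $N\ge1$, $$\sup_{\substack{A\in\mathbb C^{N\times N},\ A=A^*\le0\\ \|b\|_2=1}}\|e^{tA}b-r(A)b\|_2=\sup_{z\le0}|e_r(z)| .$$ (3) Consequently, for every $q>0$ and integer $m\ge0$, taking the infimum over $r\in\mathcal R_m(q)$ gives $$\inf_{r\in\mathcal R_m(q)}\ \sup_{\substack{A\in\mathbb C^{N\times N},\ A=A^*\le0\\ \|b\|_2=1}}\|e^{tA}b-r(A)b\|_2=\mathcal E_m^{\rm rat}(t,q),$$ i.e. $\mathcal E_m^{\rm rat}(t,q)$ is the exact minimax error when one rational function is chosen before the matrix and vector.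
   Context: $A=A^*\le0$ means a complex Hermitian negative semidefinite matrix, with spectrum $\sigma(A)$; $E_A(\Omega)$ is the orthogonal projection onto the span of the eigenvectors with eigenvalue in $\Omega$. For $q>0$ and an integer $m\ge0$, $\mathcal R_m(q)=\left\{\frac{P_m(z)}{(q-z)^m}:\ P_m\text{ a polynomial},\ \deg P_m\le m\right\}$, and $$\mathcal E_m^{\rm rat}(t,q)=\inf_{r\in\mathcal R_m(q)}\ \sup_{z\le0}|e^{tz}-r(z)| .$$ *)

theory Defs
  imports
    "HOL-Analysis.Analysis"
    "HOL-Computational_Algebra.Computational_Algebra"
    "HOL-Computational_Algebra.Field_as_Ring"
begin

text \<open>
  The library inner product on \<^typ>\<open>complex ^ 'n\<close> is the real part of the Hermitian one, so the
  latter is defined here. The library \<^const>\<open>norm\<close> on \<^typ>\<open>complex ^ 'n\<close> is the Euclidean norm.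
\<close>

definition cinner :: "complex ^ 'n \<Rightarrow> complex ^ 'n \<Rightarrow> complex" where
  "cinner x y = (\<Sum>i\<in>UNIV. x $ i * cnj (y $ i))"

definition hermitian :: "complex ^ 'n ^ 'n \<Rightarrow> bool" where
  "hermitian A \<longleftrightarrow> transpose (map_matrix cnj A) = A"

definition neg_semidef :: "complex ^ 'n ^ 'n \<Rightarrow> bool" where
  "neg_semidef A \<longleftrightarrow> hermitian A \<and> (\<forall>x. Re (cinner (A *v x) x) \<le> 0)"

text \<open>\<^term>\<open>A ^ k\<close> is not the matrix power: \<^typ>\<open>complex ^ 'n ^ 'n\<close> multiplies entrywise.\<close>

definition mat_power :: "complex ^ 'n ^ 'n \<Rightarrow> nat \<Rightarrow> complex ^ 'n ^ 'n" where
  "mat_power A k = (((**) A) ^^ k) (mat 1)"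

definition mat_exp :: "complex ^ 'n ^ 'n \<Rightarrow> complex ^ 'n ^ 'n" where
  "mat_exp A = (\<Sum>k. (1 / fact k) *\<^sub>R mat_power A k)"

definition mat_poly :: "complex poly \<Rightarrow> complex ^ 'n ^ 'n \<Rightarrow> complex ^ 'n ^ 'n" where
  "mat_poly p A = (\<Sum>i\<le>degree p. mat (coeff p i) ** mat_power A i)"

text \<open>
  Rational functions are elements of the fraction field of \<^typ>\<open>complex poly\<close>; numerator and
  denominator are those of the reduced (coprime) representation, so that the poles are exactly the
  zeros of \<open>rat_den r\<close>.
\<close>

type_synonym rat_fun = "complex poly fract"

definition rat_num :: "rat_fun \<Rightarrow> complex poly" where
  "rat_num r = fst (quot_of_fract r)"

definition rat_den :: "rat_fun \<Rightarrow> complex poly" where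
  "rat_den r = snd (quot_of_fract r)"

definition rat_poles :: "rat_fun \<Rightarrow> complex set" where
  "rat_poles r = {z. poly (rat_den r) z = 0}"

definition rat_eval :: "rat_fun \<Rightarrow> complex \<Rightarrow> complex" where
  "rat_eval r z = poly (rat_num r) z / poly (rat_den r) z"

definition rat_mat :: "rat_fun \<Rightarrow> complex ^ 'n ^ 'n \<Rightarrow> complex ^ 'n ^ 'n" where
  "rat_mat r A = mat_poly (rat_num r) A ** matrix_inv (mat_poly (rat_den r) A)"

definition rat_class :: "nat \<Rightarrow> real \<Rightarrow> rat_fun set" where
  "rat_class m q = {Fract P ([:of_real q, -1:] ^ m) | P. degree P \<le> m}"

definition rat_err :: "real \<Rightarrow> rat_fun \<Rightarrow> complex \<Rightarrow> complex" where
  "rat_err t r z = exp (of_real t * z) - rat_eval r z"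

text \<open>
  Suprema of errors are taken in \<^typ>\<open>ereal\<close>: a rational function that is unbounded at
  infinity has infinite uniform error on the half-line.
\<close>

definition best_rat_err :: "nat \<Rightarrow> real \<Rightarrow> real \<Rightarrow> ereal" where
  "best_rat_err m t q = 
     (INF r\<in>rat_class m q. SUP z\<in>{..0::real}. ereal (cmod (rat_err t r (of_real z))))"

definition mat_spectrum :: "complex ^ 'n ^ 'n \<Rightarrow> complex set" where
  "mat_spectrum A = {l. \<exists>v. v \<noteq> 0 \<and> A *v v = l *s v}"

text \<open>\<open>vec.span\<close> is the complex linear span, unlike \<^const>\<open>span\<close>, which is the real one.\<close>

definition eigen_span :: "complex ^ 'n ^ 'n \<Rightarrow> complex set \<Rightarrow> (complex ^ 'n) set" where
  "eigen_span A \<Omega> = vec.span {v. v \<noteq> 0 \<and> (\<exists>l\<in>\<Omega>. A *v v = l *s v)}"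

definition orth_proj :: "(complex ^ 'n) set \<Rightarrow> complex ^ 'n \<Rightarrow> complex ^ 'n" where
  "orth_proj S x = (THE p. p \<in> S \<and> (\<forall>y\<in>S. cinner (x - p) y = 0))"

definition spec_proj :: "complex ^ 'n ^ 'n \<Rightarrow> complex set \<Rightarrow> complex ^ 'n \<Rightarrow> complex ^ 'n" where
  "spec_proj A \<Omega> = orth_proj (eigen_span A \<Omega>)"

text \<open>
  The Borel measure \<open>\<Omega> \<mapsto> \<langle>E\<^sub>A(\<Omega>) b, b\<rangle>\<close>. The constant \<^const>\<open>measure_of\<close> returns the null measure
  if its argument is not a measure; the lemma \<open>spec_measure_eq\<close> below shows that this does not
  happen for Hermitian matrices.
\<close>

definition spec_measure :: "complex ^ 'n ^ 'n \<Rightarrow> complex ^ 'n \<Rightarrow> complex measure" where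
  "spec_measure A b =
     measure_of UNIV (sets borel) (\<lambda>\<Omega>. ennreal (Re (cinner (spec_proj A \<Omega> b) b)))"


lemma cinner_add_left: "cinner (x + y) z = cinner x z + cinner y z"
  by (simp add: cinner_def algebra_simps sum.distrib)

lemma cinner_add_right: "cinner z (x + y) = cinner z x + cinner z y"
  by (simp add: cinner_def algebra_simps sum.distrib)

lemma cinner_diff_left: "cinner (x - y) z = cinner x z - cinner y z"
  by (simp add: cinner_def algebra_simps sum_subtractf)

lemma cinner_scale_left: "cinner (c *s x) y = c * cinner x y"
  by (simp add: cinner_def sum_distrib_left mult.assoc)

lemma cinner_scale_right: "cinner x (c *s y) = cnj c * cinner x y"
  by (simp add: cinner_def sum_distrib_left algebra_simps)

lemma cinner_zero [simp]: "cinner 0 y = 0" "cinner x 0 = 0"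
  by (simp_all add: cinner_def)

lemma cinner_sum_left: "cinner (sum f I) y = (\<Sum>i\<in>I. cinner (f i) y)"
  by (induction I rule: infinite_finite_induct) (simp_all add: cinner_add_left)

lemma cnj_cinner: "cnj (cinner x y) = cinner y x"
  by (simp add: cinner_def mult.commute)

lemma Re_cinner: "Re (cinner x y) = x \<bullet> y"
  by (simp add: cinner_def inner_vec_def inner_complex_def)

lemma cinner_self: "cinner x x = of_real ((norm x)\<^sup>2)"
proof -
  have "Im (cinner x x) = 0"
    using cnj_cinner[of x x] by (simp add: complex_eq_iff)
  then show ?thesis
    by (simp add: complex_eq_iff Re_cinner power2_norm_eq_inner)
qed

lemma cinner_hermitian:
  assumes "hermitian A"
  shows "cinner (A *v x) y = cinner x (A *v y)"
proof -
  have A: "A $ i $ j = cnj (A $ j $ i)" for i j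
    using assms unfolding hermitian_def transpose_def
    by (metis (no_types, lifting) nth_map_matrix vec_lambda_beta)
  have "cinner (A *v x) y = (\<Sum>i\<in>UNIV. \<Sum>j\<in>UNIV. A $ i $ j * x $ j * cnj (y $ i))"
    by (simp add: cinner_def matrix_vector_mult_def sum_distrib_right)
  also have "\<dots> = (\<Sum>j\<in>UNIV. \<Sum>i\<in>UNIV. A $ i $ j * x $ j * cnj (y $ i))"
    by (rule sum.swap)
  also have "\<dots> = (\<Sum>j\<in>UNIV. \<Sum>i\<in>UNIV. x $ j * cnj (A $ j $ i * y $ i))"
    by (intro sum.cong refl) (subst A, simp)
  also have "\<dots> = cinner x (A *v y)"
    by (simp add: cinner_def matrix_vector_mult_def sum_distrib_left)
  finally show ?thesis .
qed

lemma eigenvectors_orthogonal: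
  assumes "hermitian A" "A *v v = l *s v" "A *v w = k *s w" "l \<noteq> k"
  shows "cinner v w = 0"
proof (cases "v = 0 \<or> w = 0")
  case False
  have real: "cnj a = a" if "A *v u = a *s u" "u \<noteq> 0" for a u
    using cinner_hermitian[OF assms(1), of u u] that
    by (simp add: cinner_scale_left cinner_scale_right cinner_self)
  have "l * cinner v w = k * cinner v w"
    using cinner_hermitian[OF assms(1), of v w] assms(2,3) real[of w k] False
    by (simp add: cinner_scale_left cinner_scale_right)
  with assms(4) show ?thesis by simp
qed auto

lemma finite_mat_spectrum:
  assumes "hermitian A"
  shows "finite (mat_spectrum A)"
proof -
  obtain f where f: "\<And>l. l \<in> mat_spectrum A \<Longrightarrow> f l \<noteq> 0 \<and> A *v f l = l *s f l"
  proof -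
    have "\<forall>l\<in>mat_spectrum A. \<exists>v. v \<noteq> 0 \<and> A *v v = l *s v"
      by (simp add: mat_spectrum_def)
    from bchoice[OF this] show ?thesis using that by blast
  qed
  have orth: "cinner (f l) (f k) = 0" if "l \<in> mat_spectrum A" "k \<in> mat_spectrum A" "l \<noteq> k" for l k
    using eigenvectors_orthogonal[OF assms] f that by blast
  have "pairwise orthogonal (f ` mat_spectrum A)"
    using orth by (fastforce simp: pairwise_def orthogonal_def simp flip: Re_cinner)
  then have "finite (f ` mat_spectrum A)"
    by (rule pairwise_orthogonal_imp_finite)
  moreover have "inj_on f (mat_spectrum A)"
  proof (rule inj_onI, rule ccontr)
    fix l k assume *: "l \<in> mat_spectrum A" "k \<in> mat_spectrum A" "f l = f k" "l \<noteq> k"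
    then have "cinner (f l) (f l) = 0" using orth by metis
    with f[OF *(1)] show False by (simp add: cinner_self)
  qed
  ultimately show ?thesis by (simp add: finite_image_iff)
qed

lemma orth_proj_ex:
  assumes "vec.subspace S"
  shows "\<exists>p. p \<in> S \<and> (\<forall>y\<in>S. cinner (x - p) y = 0)"
proof -
  have scaleR: "c *\<^sub>R v = of_real c *s v" for c and v :: "complex ^ 'n"
    by (simp add: vec_eq_iff complex_eq_iff)
  have "subspace S"
    using assms unfolding subspace_def vec.subspace_def by (simp add: scaleR)
  then have span: "span S = S" by (simp add: span_eq_iff)
  obtain p z where pz: "p \<in> span S" "\<And>w. w \<in> span S \<Longrightarrow> orthogonal z w" "x = p + z"
    using orthogonal_subspace_decomp_exists[of S x] by metis
  have "cinner z y = 0" if "y \<in> S" for y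
  proof -
    have "\<i> *s y \<in> S" using assms that by (simp add: vec.subspace_scale)
    then have "Re (cinner z (\<i> *s y)) = 0" "Re (cinner z y) = 0"
      using pz(2) that span by (auto simp: Re_cinner orthogonal_def)
    then show ?thesis by (simp add: cinner_scale_right complex_eq_iff)
  qed
  with pz span show ?thesis by (intro exI[of _ p]) auto
qed

lemma orth_proj_eqI:
  assumes "vec.subspace S" "p \<in> S" "\<And>y. y \<in> S \<Longrightarrow> cinner (x - p) y = 0"
  shows "orth_proj S x = p"
  unfolding orth_proj_def
proof (rule the_equality)
  fix p' assume p': "p' \<in> S \<and> (\<forall>y\<in>S. cinner (x - p') y = 0)"
  have S: "p' - p \<in> S" using assms p' by (simp add: vec.subspace_diff)
  have "cinner (p' - p) (p' - p) = cinner (x - p) (p' - p) - cinner (x - p') (p' - p)"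
    by (simp flip: cinner_diff_left)
  also have "\<dots> = 0" using S assms(3) p' by simp
  finally show "p' = p" by (simp add: cinner_self)
qed (use assms in auto)

lemma orth_proj:
  assumes "vec.subspace S"
  shows "orth_proj S x \<in> S" "y \<in> S \<Longrightarrow> cinner (x - orth_proj S x) y = 0"
  using orth_proj_ex[OF assms, of x] orth_proj_eqI[OF assms] by metis+

lemma cinner_spec_proj:
  assumes "hermitian A"
  shows "cinner (spec_proj A \<Omega> b) b =
    of_real (\<Sum>l\<in>mat_spectrum A \<inter> \<Omega>. (norm (spec_proj A {l} b))\<^sup>2)"
proof -
  define I where "I = mat_spectrum A \<inter> \<Omega>"
  have I: "finite I" unfolding I_def using finite_mat_spectrum[OF assms] by simp
  have sub: "vec.subspace (eigen_span A X)" for X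
    by (simp add: eigen_span_def)
  define p where "p l = spec_proj A {l} b" for l
  have single: "v \<in> eigen_span A {l} \<longleftrightarrow> A *v v = l *s v" for v l
  proof
    assume "v \<in> eigen_span A {l}"
    then show "A *v v = l *s v" unfolding eigen_span_def
      by (induction rule: vec.span_induct_alt)
        (auto simp: matrix_vector_right_distrib vec.scale vec_eq_iff algebra_simps)
  next
    assume *: "A *v v = l *s v"
    show "v \<in> eigen_span A {l}"
    proof (cases "v = 0")
      case True
      then show ?thesis by (simp add: eigen_span_def vec.span_zero)
    next
      case False
      with * show ?thesis unfolding eigen_span_def by (intro vec.span_base) auto
    qed
  qed
  have p: "A *v p l = l *s p l" for l
    using orth_proj(1)[OF sub[of "{l}"], of b] by (simp add: p_def spec_proj_def single)
  have pb: "cinner (b - p l) v = 0" if "A *v v = l *s v" for l v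
    using orth_proj(2)[OF sub[of "{l}"], of v b] that by (simp add: p_def spec_proj_def single)
  have *: "spec_proj A \<Omega> b = sum p I"
    unfolding spec_proj_def
  proof (rule orth_proj_eqI[OF sub])
    have "p l \<in> eigen_span A \<Omega>" if "l \<in> I" for l
    proof (cases "p l = 0")
      case False
      with p that show ?thesis unfolding eigen_span_def I_def by (intro vec.span_base) auto
    qed (simp add: eigen_span_def vec.span_zero)
    then show "sum p I \<in> eigen_span A \<Omega>"
      unfolding eigen_span_def by (intro vec.span_sum)
  next
    fix y assume "y \<in> eigen_span A \<Omega>"
    then show "cinner (b - sum p I) y = 0" unfolding eigen_span_def
    proof (induction rule: vec.span_induct_alt)
      case (step c v y)
      then obtain l where l: "v \<noteq> 0" "l \<in> \<Omega>" "A *v v = l *s v" by auto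
      then have lI: "l \<in> I" by (auto simp: I_def mat_spectrum_def)
      have "cinner (sum p I) v = (\<Sum>k\<in>I. cinner (p k) v)"
        by (rule cinner_sum_left)
      also have "\<dots> = (\<Sum>k\<in>I. if k = l then cinner (p l) v else 0)"
        by (intro sum.cong refl) (use eigenvectors_orthogonal[OF assms p l(3)] in auto)
      also have "\<dots> = cinner (p l) v" using I lI by simp
      also have "\<dots> = cinner b v" using pb[OF l(3)] by (simp add: cinner_diff_left)
      finally show ?case using step
        by (simp add: cinner_add_right cinner_scale_right cinner_diff_left)
    qed simp
  qed
  have "cinner (p l) b = of_real ((norm (p l))\<^sup>2)" for l
  proof -
    have "cinner (p l) b = cnj (cinner b (p l))" by (simp add: cnj_cinner)
    also have "cinner b (p l) = cinner (p l) (p l)"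
      using pb[OF p, of l] by (simp add: cinner_diff_left)
    finally show ?thesis by (simp add: cinner_self)
  qed
  then show ?thesis by (simp add: * cinner_sum_left p_def flip: I_def)
qed

lemma spec_measure_eq:
  assumes "hermitian A" and \<Omega>: "\<Omega> \<in> sets borel"
  shows "emeasure (spec_measure A b) \<Omega> = ennreal (Re (cinner (spec_proj A \<Omega> b) b))"
    and "complex_of_real (measure (spec_measure A b) \<Omega>) = cinner (spec_proj A \<Omega> b) b"
proof -
  let ?w = "\<lambda>l. (norm (spec_proj A {l} b))\<^sup>2"
  define N where "N = distr (point_measure (mat_spectrum A) (\<lambda>l. ennreal (?w l))) borel id"
  note fin = finite_mat_spectrum[OF assms(1)]
  have N: "emeasure N X = ennreal (Re (cinner (spec_proj A X b) b))" if "X \<in> sets borel" for X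
  proof -
    have "emeasure N X = emeasure (point_measure (mat_spectrum A) (\<lambda>l. ennreal (?w l))) (mat_spectrum A \<inter> X)"
      unfolding N_def using that by (subst emeasure_distr) (auto simp: space_point_measure Int_commute)
    also have "\<dots> = (\<Sum>l\<in>mat_spectrum A \<inter> X. ennreal (?w l))"
      using fin by (subst emeasure_point_measure_finite) auto
    finally show ?thesis
      by (simp add: cinner_spec_proj[OF assms(1)] sum_nonneg)
  qed
  have sets_N: "sets N = sets borel" and space_N: "space N = UNIV"
    by (simp_all add: N_def)
  have "spec_measure A b = measure_of (space N) (sets N) (emeasure N)"
    unfolding spec_measure_def
    by (subst measure_of_eq[where \<mu>' = "emeasure N"])
       (use sets.sigma_sets_eq[of "borel :: complex measure"] in \<open>auto simp: N sets_N space_N\<close>)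
  then have *: "spec_measure A b = N" by (simp add: measure_of_of_measure)
  show e: "emeasure (spec_measure A b) \<Omega> = ennreal (Re (cinner (spec_proj A \<Omega> b) b))"
    using N[OF \<Omega>] by (simp add: *)
  show "complex_of_real (measure (spec_measure A b) \<Omega>) = cinner (spec_proj A \<Omega> b) b"
    using e by (simp add: measure_def cinner_spec_proj[OF assms(1)] sum_nonneg)
qed

end

theory Submission
  imports Defs
begin

text \<open>
  A Hermitian matrix splits every vector into its spectral components
  \<open>b = (\<Sum>\<lambda>. p\<^sub>\<lambda>)\<close>, where \<open>p\<^sub>\<lambda> = E\<^sub>A({\<lambda>}) b\<close> is an eigenvector (or zero) and distinct components
  are orthogonal (\<open>spectral_decomposition\<close>). A matrix built from \<open>A\<close> by a power series or a rational
  expression acts on each \<open>p\<^sub>\<lambda>\<close> as multiplication by the value of the corresponding scalar function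
  at \<open>\<lambda>\<close>, so the error matrix acts as multiplication by \<open>e\<^sub>r(\<lambda>)\<close>, and Pythagoras gives
  \<open>\<parallel>e\<^sup>t\<^sup>A b - r(A) b\<parallel>\<^sup>2 = (\<Sum>\<lambda>. \<bar>e\<^sub>r(\<lambda>)\<bar>\<^sup>2 \<parallel>p\<^sub>\<lambda>\<parallel>\<^sup>2)\<close> (\<open>mat_error_norm\<close>). The spectral measure of \<open>b\<close> is a
  finite sum of point masses \<open>\<parallel>p\<^sub>\<lambda>\<parallel>\<^sup>2\<close> at the eigenvalues, so the right-hand side is the integral in
  the statement (\<open>integral_spec_measure\<close>).

  For a unit vector the masses sum to one, so the error is at most the largest value of \<open>\<bar>e\<^sub>r\<bar>\<close> on the
  spectrum, which lies in \<open>(-\<infinity>, 0]\<close>. Conversely every value \<open>\<bar>e\<^sub>r(z)\<bar>\<close> with \<open>z \<le> 0\<close> is attained, in any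
  dimension, by the scalar matrix \<open>z I\<close>. Hence the two suprema agree (\<open>SUP_mat_error\<close>). They agree in
  particular for every \<open>r\<close> whose only possible pole is \<open>q > 0\<close> (\<open>rat_class_poles\<close>), and taking infima
  over these \<open>r\<close> preserves the equality.
\<close>

section \<open>The spectral theorem for Hermitian matrices\<close>

lemma eigen_span_singleton: "v \<in> eigen_span A {l} \<longleftrightarrow> A *v v = l *s v"
proof
  assume "v \<in> eigen_span A {l}"
  then show "A *v v = l *s v"
    unfolding eigen_span_def
    by (induction rule: vec.span_induct_alt)
      (auto simp: matrix_vector_right_distrib vec.scale vec_eq_iff algebra_simps)
next
  assume eig: "A *v v = l *s v"
  show "v \<in> eigen_span A {l}"
  proof (cases "v = 0")
    case True
    then show ?thesis by (simp add: eigen_span_def vec.span_zero)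
  next
    case False
    with eig show ?thesis unfolding eigen_span_def by (intro vec.span_base) auto
  qed
qed

lemma subspace_eigen_span: "vec.subspace (eigen_span A \<Omega>)"
  by (simp add: eigen_span_def)

lemma spec_proj_eigenvector: "A *v spec_proj A {l} b = l *s spec_proj A {l} b"
  using orth_proj(1)[OF subspace_eigen_span[of A "{l}"], of b]
  by (simp add: spec_proj_def eigen_span_singleton)

lemma spec_proj_residual_orthogonal:
  assumes "A *v v = l *s v"
  shows "cinner (b - spec_proj A {l} b) v = 0"
  using orth_proj(2)[OF subspace_eigen_span[of A "{l}"], of v b] assms
  by (simp add: spec_proj_def eigen_span_singleton)

lemma hermitian_inner_commute:
  assumes "hermitian A"
  shows "(A *v x) \<bullet> y = x \<bullet> (A *v y)"
  using cinner_hermitian[OF assms, of x y] by (simp flip: Re_cinner)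

lemma matrix_vector_mult_scaleR_right:
  fixes A :: "complex ^ 'n ^ 'n"
  shows "A *v (c *\<^sub>R x) = c *\<^sub>R (A *v x)"
  by (rule linear_scale) simp

text \<open>
  The Rayleigh quotient \<open>x \<bullet> A x\<close> attains its maximum \<open>m\<close> on the unit sphere of \<open>W\<close>, and a maximiser
  is an eigenvector. It suffices that \<open>W\<close> is a real subspace: the real part of the Hermitian product
  is a real inner product for which \<open>A\<close> is symmetric.
\<close>

lemma hermitian_invariant_subspace_eigenvector:
  fixes A :: "complex ^ 'n ^ 'n"
  assumes A: "hermitian A" and W: "subspace W" "\<And>x. x \<in> W \<Longrightarrow> A *v x \<in> W" "W \<noteq> {0}"
  obtains m :: real and x where "x \<in> W" "x \<noteq> 0" "A *v x = of_real m *s x"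
proof -
  have "compact (W \<inter> sphere 0 1)"
    using closed_subspace[OF W(1)] by (simp add: closed_Int_compact)
  moreover have "W \<inter> sphere 0 1 \<noteq> {}"
  proof -
    obtain w where "w \<in> W" "w \<noteq> 0" using W(1,3) subspace_0 by blast
    then have "(1 / norm w) *\<^sub>R w \<in> W \<inter> sphere 0 1"
      using W(1) by (simp add: subspace_scale)
    then show ?thesis by blast
  qed
  moreover have "continuous_on (W \<inter> sphere 0 1) (\<lambda>x. (A *v x) \<bullet> x)"
    by (intro continuous_intros linear_continuous_on) simp
  ultimately obtain x where x: "x \<in> W \<inter> sphere 0 1"
    and max: "\<And>y. y \<in> W \<inter> sphere 0 1 \<Longrightarrow> (A *v y) \<bullet> y \<le> (A *v x) \<bullet> x"
    using continuous_attains_sup[of "W \<inter> sphere 0 1" "\<lambda>x. (A *v x) \<bullet> x"] by blast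
  \<comment> \<open>\<open>B = m I - A\<close> is positive semidefinite on \<open>W\<close> and its quadratic form vanishes at \<open>x\<close>, so
    \<open>B x = 0\<close>: otherwise a small step from \<open>x\<close> in the direction \<open>- B x\<close> makes the form negative.\<close>
  define m where "m = (A *v x) \<bullet> x"
  define B where "B y = m *\<^sub>R y - A *v y" for y
  have linB: "B (y + c *\<^sub>R z) = B y + c *\<^sub>R B z" for y z c
    by (simp add: B_def matrix_vector_right_distrib matrix_vector_mult_scaleR_right algebra_simps)
  have nonneg: "0 \<le> B y \<bullet> y" if "y \<in> W" for y
  proof (cases "y = 0")
    case False
    define c where "c = 1 / norm y"
    have "c *\<^sub>R y \<in> W \<inter> sphere 0 1"
      using False that W(1) by (simp add: subspace_scale c_def)
    from max[OF this] have "c\<^sup>2 * ((A *v y) \<bullet> y) \<le> m"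
      by (simp add: matrix_vector_mult_scaleR_right m_def power2_eq_square mult.assoc)
    moreover have "c\<^sup>2 * (y \<bullet> y) = 1"
      using False by (simp add: c_def power2_norm_eq_inner[symmetric] field_simps)
    ultimately have "0 \<le> c\<^sup>2 * (B y \<bullet> y)"
      by (simp add: B_def inner_diff_left right_diff_distrib mult.left_commute)
    moreover have "c\<^sup>2 > 0" using False by (simp add: c_def)
    ultimately show ?thesis by (simp add: zero_le_mult_iff)
  qed simp
  have xB: "B x \<bullet> x = 0"
    using x by (simp add: B_def m_def inner_diff_left power2_norm_eq_inner[symmetric])
  have BW: "B y \<in> W" if "y \<in> W" for y
    using that W(1,2) by (simp add: B_def subspace_diff subspace_scale)
  define c d where "c = B x \<bullet> B x" and "d = B (B x) \<bullet> B x"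
  \<comment> \<open>The form at \<open>x - s B x\<close> is \<open>s (s d - 2 c)\<close>; this step length keeps \<open>s d\<close> below \<open>c\<close>, and the
    summand 1 covers \<open>d = 0\<close>.\<close>
  define s where "s = c / (d + 1)"
  have c: "c \<ge> 0" by (simp add: c_def)
  have d: "d \<ge> 0" unfolding d_def using x by (intro nonneg BW) auto
  have "B y \<bullet> z = y \<bullet> B z" for y z
    by (simp add: B_def inner_diff_left inner_diff_right hermitian_inner_commute[OF A])
  then have sym: "B (B x) \<bullet> x = c"
    by (simp add: c_def)
  have "0 \<le> B (x + (- s) *\<^sub>R B x) \<bullet> (x + (- s) *\<^sub>R B x)"
    using x W(1) by (intro nonneg subspace_add subspace_scale BW) auto
  also have "\<dots> = s * (s * d - 2 * c)"
    unfolding linB using xB sym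
    by (simp add: inner_add_left inner_diff_left inner_diff_right algebra_simps
        flip: c_def d_def)
  finally have *: "0 \<le> s * (s * d - 2 * c)" .
  have "c = 0"
  proof (rule ccontr)
    assume "c \<noteq> 0"
    with c d have "s > 0" "s * d \<le> c" by (simp_all add: s_def field_simps)
    with * \<open>c \<noteq> 0\<close> c show False by (simp add: zero_le_mult_iff)
  qed
  then have "A *v x = of_real m *s x"
    by (simp add: c_def B_def vec_eq_iff complex_eq_iff)
  moreover have "x \<noteq> 0" using x by auto
  ultimately show ?thesis using x that by blast
qed

lemma spec_proj_orthogonal:
  assumes "hermitian A" "l \<noteq> k"
  shows "cinner (spec_proj A {l} b) (spec_proj A {k} b) = 0"
  using eigenvectors_orthogonal[OF assms(1) spec_proj_eigenvector spec_proj_eigenvector assms(2)] .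

text \<open>
  The vectors orthogonal to all eigenvectors form an \<open>A\<close>-invariant subspace. If it were nonzero, it
  would contain an eigenvector, which would be orthogonal to itself. The difference of the two sides
  lies in this subspace.
\<close>

theorem spectral_decomposition:
  fixes A :: "complex ^ 'n ^ 'n"
  assumes A: "hermitian A"
  shows "(\<Sum>l\<in>mat_spectrum A. spec_proj A {l} b) = b"
proof -
  let ?p = "\<lambda>l. spec_proj A {l} b"
  define z where "z = b - (\<Sum>l\<in>mat_spectrum A. ?p l)"
  define E where "E = {v. \<exists>l. A *v v = l *s v}"
  define W where "W = {x. \<forall>v\<in>E. cinner x v = 0}"
  have scaleR: "c *\<^sub>R x = of_real c *s x" for c and x :: "complex ^ 'n"
    by (simp add: vec_eq_iff complex_eq_iff)
  have "z \<in> W"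
    unfolding W_def
  proof (intro CollectI ballI)
    fix v assume "v \<in> E"
    then obtain l where v: "A *v v = l *s v" by (auto simp: E_def)
    show "cinner z v = 0"
    proof (cases "v = 0")
      case False
      with v have l: "l \<in> mat_spectrum A" by (auto simp: mat_spectrum_def)
      have "cinner (\<Sum>k\<in>mat_spectrum A. ?p k) v = (\<Sum>k\<in>mat_spectrum A. cinner (?p k) v)"
        by (rule cinner_sum_left)
      also have "\<dots> = (\<Sum>k\<in>mat_spectrum A. if k = l then cinner (?p l) v else 0)"
        by (intro sum.cong refl)
          (use eigenvectors_orthogonal[OF A spec_proj_eigenvector v] in auto)
      also have "\<dots> = cinner (?p l) v"
        using l finite_mat_spectrum[OF A] by simp
      also have "\<dots> = cinner b v"
        using spec_proj_residual_orthogonal[OF v] by (simp add: cinner_diff_left)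
      finally show ?thesis by (simp add: z_def cinner_diff_left)
    qed simp
  qed
  have "W = {0}"
  proof (rule ccontr)
    assume "W \<noteq> {0}"
    moreover have "subspace W"
      unfolding subspace_def W_def
      by (auto simp: cinner_add_left scaleR cinner_scale_left)
    moreover have "A *v x \<in> W" if "x \<in> W" for x
      using that by (auto simp: W_def E_def cinner_hermitian[OF A] cinner_scale_right)
    ultimately obtain m x where "x \<in> W" "x \<noteq> 0" "A *v x = of_real m *s x"
      using hermitian_invariant_subspace_eigenvector[OF A] by metis
    then have "cinner x x = 0" by (auto simp: W_def E_def)
    with \<open>x \<noteq> 0\<close> show False by (simp add: cinner_self)
  qed
  with \<open>z \<in> W\<close> show ?thesis by (simp add: z_def)
qed

section \<open>Functions of a Hermitian matrix\<close>

text \<open>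
  This replaces a functional calculus: to know a matrix \<open>F\<close>, it is enough to know that it acts on the
  eigenvectors of \<open>A\<close> as a scalar function \<open>f\<close> of the eigenvalue.
\<close>

lemma matrix_vector_mult_eq_spectral_sum:
  fixes A F :: "complex ^ 'n ^ 'n"
  assumes A: "hermitian A" and F: "\<And>l v. l \<in> mat_spectrum A \<Longrightarrow> A *v v = l *s v \<Longrightarrow> F *v v = f l *s v"
  shows "F *v b = (\<Sum>l\<in>mat_spectrum A. f l *s spec_proj A {l} b)"
proof -
  have "F *v b = F *v (\<Sum>l\<in>mat_spectrum A. spec_proj A {l} b)"
    by (simp add: spectral_decomposition[OF A])
  also have "\<dots> = (\<Sum>l\<in>mat_spectrum A. F *v spec_proj A {l} b)"
    by (rule vec.linear_sum) simp
  also have "\<dots> = (\<Sum>l\<in>mat_spectrum A. f l *s spec_proj A {l} b)"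
    by (intro sum.cong refl F spec_proj_eigenvector)
  finally show ?thesis .
qed

lemma norm_spectral_sum:
  assumes A: "hermitian A"
  shows "(norm (\<Sum>l\<in>mat_spectrum A. f l *s spec_proj A {l} b))\<^sup>2 =
    (\<Sum>l\<in>mat_spectrum A. (cmod (f l))\<^sup>2 * (norm (spec_proj A {l} b))\<^sup>2)"
proof -
  let ?v = "\<lambda>l. f l *s spec_proj A {l} b"
  have "(norm (sum ?v (mat_spectrum A)))\<^sup>2 = (\<Sum>l\<in>mat_spectrum A. (norm (?v l))\<^sup>2)"
  proof (rule norm_sum_Pythagorean[OF finite_mat_spectrum[OF A]])
    show "pairwise (\<lambda>i j. orthogonal (?v i) (?v j)) (mat_spectrum A)"
      using spec_proj_orthogonal[OF A]
      by (auto simp: pairwise_def orthogonal_def cinner_scale_left cinner_scale_right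
          simp flip: Re_cinner)
  qed
  moreover have "(norm (?v l))\<^sup>2 = (cmod (f l))\<^sup>2 * (norm (spec_proj A {l} b))\<^sup>2" for l
  proof -
    have "complex_of_real ((norm (?v l))\<^sup>2) = f l * cnj (f l) * complex_of_real ((norm (spec_proj A {l} b))\<^sup>2)"
      unfolding cinner_self[symmetric] by (simp add: cinner_scale_left cinner_scale_right)
    also have "\<dots> = complex_of_real ((cmod (f l))\<^sup>2 * (norm (spec_proj A {l} b))\<^sup>2)"
      by (simp only: complex_norm_square[symmetric] of_real_mult)
    finally show ?thesis using of_real_eq_iff by blast
  qed
  ultimately show ?thesis by simp
qed

lemma mat_mult_vector: "mat c *v x = c *s x"
  by (simp add: vec_eq_iff matrix_vector_mult_def mat_def if_distrib[where f = "\<lambda>a. a * _"] cong: if_cong)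

lemma scaleR_matrix_vector_mult:
  fixes A :: "complex ^ 'n ^ 'n"
  shows "(c *\<^sub>R A) *v x = c *\<^sub>R (A *v x)"
  by (simp add: vec_eq_iff matrix_vector_mult_def scaleR_sum_right)

lemma mat_power_eigenvector:
  assumes "A *v v = l *s v"
  shows "mat_power A k *v v = l ^ k *s v"
proof (induction k)
  case (Suc k)
  have "mat_power A (Suc k) *v v = A *v (mat_power A k *v v)"
    by (simp add: mat_power_def matrix_vector_mul_assoc)
  with Suc assms show ?case
    by (simp add: vec.scale mult.commute)
qed (simp add: mat_power_def)

lemma sum_matrix_vector_mult:
  fixes M :: "'i \<Rightarrow> complex ^ 'n ^ 'n"
  shows "(\<Sum>i\<in>I. M i) *v x = (\<Sum>i\<in>I. M i *v x)"
  by (induction I rule: infinite_finite_induct) (simp_all add: matrix_vector_mult_add_rdistrib)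

lemma mat_poly_eigenvector:
  assumes "A *v v = l *s v"
  shows "mat_poly p A *v v = poly p l *s v"
  using mat_power_eigenvector[OF assms]
  by (simp add: mat_poly_def sum_matrix_vector_mult mat_mult_vector poly_altdef
      vec.scale_sum_left flip: matrix_vector_mul_assoc)

text \<open>
  The denominator \<open>D\<close> is invertible because it is onto: dividing the spectral components of \<open>b\<close> by the
  nonzero values of the denominator gives a preimage of \<open>b\<close>.
\<close>

lemma rat_mat_eigenvector:
  fixes A :: "complex ^ 'n ^ 'n"
  assumes A: "hermitian A" and poles: "rat_poles r \<inter> mat_spectrum A = {}"
    and l: "l \<in> mat_spectrum A" and v: "A *v v = l *s v"
  shows "rat_mat r A *v v = rat_eval r l *s v"
proof -
  define D where "D = mat_poly (rat_den r) A"
  have nz: "poly (rat_den r) k \<noteq> 0" if "k \<in> mat_spectrum A" for k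
    using poles that by (auto simp: rat_poles_def)
  have "surj ((*v) D)"
  proof (rule surjI)
    fix b
    have "D *v (\<Sum>k\<in>mat_spectrum A. (1 / poly (rat_den r) k) *s spec_proj A {k} b)
        = (\<Sum>k\<in>mat_spectrum A. D *v ((1 / poly (rat_den r) k) *s spec_proj A {k} b))"
      by (rule vec.linear_sum) simp
    also have "\<dots> = (\<Sum>k\<in>mat_spectrum A. spec_proj A {k} b)"
      by (intro sum.cong refl)
        (simp add: D_def nz vec.scale mat_poly_eigenvector[OF spec_proj_eigenvector])
    finally show "D *v (\<Sum>k\<in>mat_spectrum A. (1 / poly (rat_den r) k) *s spec_proj A {k} b) = b"
      by (simp add: spectral_decomposition[OF A])
  qed
  then obtain D' where "D ** D' = mat 1"
    using matrix_right_invertible_surjective[of D] by blast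
  then have "D ** D' = mat 1 \<and> D' ** D = mat 1"
    using matrix_left_right_inverse[of D D'] by simp
  then have inv: "matrix_inv D ** D = mat 1"
    unfolding matrix_inv_def by (rule someI2) simp
  have "v = matrix_inv D *v (D *v v)"
    by (simp add: matrix_vector_mul_assoc inv)
  then have "v = poly (rat_den r) l *s (matrix_inv D *v v)"
    by (simp add: D_def mat_poly_eigenvector[OF v] vec.scale)
  then have "(1 / poly (rat_den r) l) *s v = matrix_inv D *v v"
    using nz[OF l] by (metis (no_types, lifting) divide_self_if mult.commute times_divide_eq_right
        mult.right_neutral vector_smult_assoc vector_smult_lid)
  then have "rat_mat r A *v v = mat_poly (rat_num r) A *v ((1 / poly (rat_den r) l) *s v)"
    by (simp add: rat_mat_def D_def flip: matrix_vector_mul_assoc)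
  then show ?thesis
    by (simp add: vec.scale mat_poly_eigenvector[OF v] rat_eval_def)
qed

lemma tendsto_matrix_pointwise:
  fixes M :: "nat \<Rightarrow> complex ^ 'n ^ 'n"
  assumes "\<And>b. (\<lambda>n. M n *v b) \<longlonglongrightarrow> L b"
  shows "M \<longlonglongrightarrow> matrix L"
proof (intro vec_tendstoI)
  fix i j
  have "(\<lambda>n. (M n *v axis j 1) $ i) \<longlonglongrightarrow> L (axis j 1) $ i"
    by (intro tendsto_vec_nth assms)
  then show "(\<lambda>n. M n $ i $ j) \<longlonglongrightarrow> matrix L $ i $ j"
    by (simp add: matrix_def matrix_vector_mult_def axis_def if_distrib cong: if_cong)
qed

lemma tendsto_matrix_vector_mult:
  fixes M :: "nat \<Rightarrow> complex ^ 'n ^ 'n"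
  assumes "M \<longlonglongrightarrow> L"
  shows "(\<lambda>n. M n *v b) \<longlonglongrightarrow> L *v b"
  unfolding matrix_vector_mult_def
  by (intro vec_tendstoI) (auto intro!: tendsto_intros tendsto_vec_nth assms)

lemma tendsto_vector_scalar_mult:
  fixes c :: "nat \<Rightarrow> complex"
  assumes "c \<longlonglongrightarrow> l"
  shows "(\<lambda>n. c n *s x) \<longlonglongrightarrow> l *s x"
  by (intro vec_tendstoI) (auto intro!: tendsto_intros assms)

text \<open>
  The series that defines \<open>mat_exp\<close> has to be shown to converge before its action on \<open>v\<close> can be computed.
  Convergence follows from the action on an arbitrary vector, whose spectral components are multiplied
  by partial sums of scalar exponential series.
\<close>

lemma mat_exp_eigenvector:
  fixes A :: "complex ^ 'n ^ 'n"
  assumes A: "hermitian A" and v: "A *v v = l *s v"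
  shows "mat_exp A *v v = exp l *s v"
proof -
  define S where "S n = (\<Sum>k<n. (1 / fact k) *\<^sub>R mat_power A k)" for n
  define e where "e n z = (\<Sum>k<n. z ^ k /\<^sub>R fact k)" for n and z :: complex
  have e: "(\<lambda>n. e n z) \<longlonglongrightarrow> exp z" for z
    using exp_converges[of z] by (simp add: sums_def e_def)
  have S: "S n *v u = e n z *s u" if "A *v u = z *s u" for n z u
  proof -
    have "((1 / fact k) *\<^sub>R mat_power A k) *v u = (z ^ k /\<^sub>R fact k) *s u" for k
      using mat_power_eigenvector[OF that, of k]
      by (simp add: vec_eq_iff scaleR_matrix_vector_mult divide_inverse)
    then show ?thesis
      by (simp add: S_def e_def sum_matrix_vector_mult vec.scale_sum_left)
  qed
  have "(\<lambda>n. S n *v b) \<longlonglongrightarrow> (\<Sum>z\<in>mat_spectrum A. exp z *s spec_proj A {z} b)" for b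
    by (subst matrix_vector_mult_eq_spectral_sum[OF A S])
      (auto intro!: tendsto_sum tendsto_vector_scalar_mult e)
  from tendsto_matrix_pointwise[OF this]
  have "(\<lambda>k. (1 / fact k) *\<^sub>R mat_power A k) sums
      matrix (\<lambda>b. \<Sum>z\<in>mat_spectrum A. exp z *s spec_proj A {z} b)"
    by (simp add: sums_def S_def)
  then have "S \<longlonglongrightarrow> mat_exp A"
    by (simp add: mat_exp_def sums_def S_def[abs_def] flip: sums_unique)
  then have "(\<lambda>n. e n l *s v) \<longlonglongrightarrow> mat_exp A *v v"
    using tendsto_matrix_vector_mult[of S "mat_exp A" v] by (simp add: S[OF v])
  with tendsto_vector_scalar_mult[OF e] show ?thesis
    by (rule LIMSEQ_unique[rotated])
qed

section \<open>The error identity\<close>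

lemma mat_error_eigenvector:
  fixes A :: "complex ^ 'n ^ 'n"
  assumes A: "hermitian A" and poles: "rat_poles r \<inter> mat_spectrum A = {}"
    and l: "l \<in> mat_spectrum A" and v: "A *v v = l *s v"
  shows "(mat_exp (t *\<^sub>R A) - rat_mat r A) *v v = rat_err t r l *s v"
proof -
  have "hermitian (t *\<^sub>R A)"
    using A by (simp add: hermitian_def vec_eq_iff transpose_def map_matrix_def)
  moreover have "(t *\<^sub>R A) *v v = (of_real t * l) *s v"
    unfolding scaleR_matrix_vector_mult v by (simp add: vec_eq_iff complex_eq_iff algebra_simps)
  ultimately have "mat_exp (t *\<^sub>R A) *v v = exp (of_real t * l) *s v"
    by (rule mat_exp_eigenvector)
  then show ?thesis
    using rat_mat_eigenvector[OF assms]
    by (simp add: matrix_vector_mult_diff_rdistrib rat_err_def vec.scale_left_diff_distrib)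
qed

lemma mat_error_norm:
  fixes A :: "complex ^ 'n ^ 'n"
  assumes A: "hermitian A" and poles: "rat_poles r \<inter> mat_spectrum A = {}"
  shows "(norm (mat_exp (t *\<^sub>R A) *v b - rat_mat r A *v b))\<^sup>2 =
    (\<Sum>l\<in>mat_spectrum A. (cmod (rat_err t r l))\<^sup>2 * (norm (spec_proj A {l} b))\<^sup>2)"
proof -
  have "mat_exp (t *\<^sub>R A) *v b - rat_mat r A *v b = (mat_exp (t *\<^sub>R A) - rat_mat r A) *v b"
    by (simp add: matrix_vector_mult_diff_rdistrib)
  also have "\<dots> = (\<Sum>l\<in>mat_spectrum A. rat_err t r l *s spec_proj A {l} b)"
    by (rule matrix_vector_mult_eq_spectral_sum[OF A mat_error_eigenvector[OF A poles]])
  finally show ?thesis by (simp only: norm_spectral_sum[OF A])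
qed

lemma norm_eq_sum_spec_proj:
  fixes A :: "complex ^ 'n ^ 'n"
  assumes A: "hermitian A"
  shows "(norm b)\<^sup>2 = (\<Sum>l\<in>mat_spectrum A. (norm (spec_proj A {l} b))\<^sup>2)"
  using norm_spectral_sum[OF A, of "\<lambda>_. 1" b] by (simp add: spectral_decomposition[OF A])

lemma neg_semidef_spectrum:
  assumes A: "neg_semidef A"
  shows "mat_spectrum A \<subseteq> of_real ` {..0::real}"
proof
  fix l assume "l \<in> mat_spectrum A"
  then obtain v where v: "v \<noteq> 0" "A *v v = l *s v" by (auto simp: mat_spectrum_def)
  have H: "hermitian A" and neg: "Re (cinner (A *v v) v) \<le> 0"
    using A by (auto simp: neg_semidef_def)
  have "l = cnj l"
    using cinner_hermitian[OF H, of v v] v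
    by (simp add: cinner_scale_left cinner_scale_right cinner_self)
  then have "l = of_real (Re l)" by (simp add: complex_eq_iff)
  moreover have "Re l * (norm v)\<^sup>2 \<le> 0"
    using neg v(2) by (simp add: cinner_scale_left cinner_self flip: of_real_power)
  then have "Re l \<le> 0" using v(1) by (simp add: mult_le_0_iff)
  ultimately show "l \<in> of_real ` {..0::real}" by blast
qed

text \<open>
  On the finite spectrum every \<open>f\<close> is a combination of indicators of points, so both parts reduce to
  the masses of single points.
\<close>

lemma integral_spec_measure:
  fixes f :: "complex \<Rightarrow> real"
  assumes A: "hermitian A"
  shows "set_integrable (spec_measure A b) (mat_spectrum A) f"
    and "(LINT l:mat_spectrum A|spec_measure A b. f l) =
      (\<Sum>l\<in>mat_spectrum A. f l * (norm (spec_proj A {l} b))\<^sup>2)"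
proof -
  have sets: "sets (spec_measure A b) = sets borel"
    using sets.sigma_sets_eq[of "borel :: complex measure"] by (simp add: spec_measure_def)
  have mass: "measure (spec_measure A b) {l} = (norm (spec_proj A {l} b))\<^sup>2"
    if "l \<in> mat_spectrum A" for l
  proof -
    have "complex_of_real (measure (spec_measure A b) {l}) =
        complex_of_real ((norm (spec_proj A {l} b))\<^sup>2)"
      using that by (simp add: spec_measure_eq(2)[OF A] cinner_spec_proj[OF A])
    then show ?thesis using of_real_eq_iff by blast
  qed
  have ind: "indicator (mat_spectrum A) x *\<^sub>R f x =
      (\<Sum>l\<in>mat_spectrum A. f l * indicator {l} x)" for x
    using finite_mat_spectrum[OF A]
    by (simp add: indicator_def if_distrib[where f = "\<lambda>a. _ * a"] cong: if_cong)
  have int: "integrable (spec_measure A b) (\<lambda>x. f l * indicator {l} x)" for l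
    by (intro integrable_mult_right integrable_real_indicator)
      (simp_all add: sets spec_measure_eq(1)[OF A])
  show "set_integrable (spec_measure A b) (mat_spectrum A) f"
    unfolding set_integrable_def ind by (intro Bochner_Integration.integrable_sum int)
  show "(LINT l:mat_spectrum A|spec_measure A b. f l) =
      (\<Sum>l\<in>mat_spectrum A. f l * (norm (spec_proj A {l} b))\<^sup>2)"
    unfolding set_lebesgue_integral_def ind
    by (subst Bochner_Integration.integral_sum[OF int]) (simp add: sets mass)
qed

section \<open>The worst case over matrices\<close>

lemma mat_error_le_spectral_value:
  fixes A :: "complex ^ 'n ^ 'n"
  assumes A: "hermitian A" and poles: "rat_poles r \<inter> mat_spectrum A = {}" and b: "norm b = 1"
  obtains l where "l \<in> mat_spectrum A"
    "norm (mat_exp (t *\<^sub>R A) *v b - rat_mat r A *v b) \<le> cmod (rat_err t r l)"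
proof -
  define M where "M = Max ((\<lambda>l. cmod (rat_err t r l)) ` mat_spectrum A)"
  have "mat_spectrum A \<noteq> {}"
    using b norm_eq_sum_spec_proj[OF A, of b] by auto
  then have "M \<in> (\<lambda>l. cmod (rat_err t r l)) ` mat_spectrum A"
    unfolding M_def using finite_mat_spectrum[OF A] by (intro Max_in) auto
  then obtain l where l: "l \<in> mat_spectrum A" "M = cmod (rat_err t r l)" by blast
  have "(norm (mat_exp (t *\<^sub>R A) *v b - rat_mat r A *v b))\<^sup>2
      \<le> (\<Sum>k\<in>mat_spectrum A. M\<^sup>2 * (norm (spec_proj A {k} b))\<^sup>2)"
    unfolding mat_error_norm[OF A poles]
    using finite_mat_spectrum[OF A]
    by (intro sum_mono mult_right_mono power_mono) (auto simp: M_def)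
  also have "\<dots> = M\<^sup>2"
    using norm_eq_sum_spec_proj[OF A, of b] b by (simp flip: sum_distrib_left)
  finally have "norm (mat_exp (t *\<^sub>R A) *v b - rat_mat r A *v b) \<le> M"
    by (rule power2_le_imp_le) (simp add: l)
  with l that show ?thesis by blast
qed

text \<open>
  Every vector is an eigenvector of \<open>z I\<close>, so the pointwise scalar error is attained with any unit
  vector.
\<close>

lemma scalar_matrix_error:
  fixes b :: "complex ^ 'n"
  assumes "of_real z \<notin> rat_poles r" "z \<le> 0" "norm b = 1"
  shows "neg_semidef (mat (of_real z) :: complex ^ 'n ^ 'n)"
    and "norm (mat_exp (t *\<^sub>R mat (of_real z)) *v b - rat_mat r (mat (of_real z)) *v b) =
      cmod (rat_err t r (of_real z))"
proof -
  let ?A = "mat (of_real z) :: complex ^ 'n ^ 'n"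
  have H: "hermitian ?A"
    by (auto simp: hermitian_def vec_eq_iff transpose_def map_matrix_def mat_def)
  show "neg_semidef ?A"
    using H assms(2)
    by (simp add: neg_semidef_def mat_mult_vector cinner_scale_left cinner_self mult_nonpos_nonneg
        flip: of_real_power)
  have spec: "mat_spectrum ?A = {of_real z}"
  proof -
    have "b \<noteq> 0" using assms(3) by auto
    then show ?thesis
      by (auto simp: mat_spectrum_def mat_mult_vector vec.scale_cancel_right)
  qed
  have "(mat_exp (t *\<^sub>R ?A) - rat_mat r ?A) *v b = rat_err t r (of_real z) *s b"
    using assms(1) by (intro mat_error_eigenvector H) (auto simp: spec mat_mult_vector)
  \<comment> \<open>The spectral decomposition of \<open>b\<close> has a single term, so Pythagoras gives the norm of a multiple.\<close>
  moreover have "(norm (c *s b))\<^sup>2 = (cmod c)\<^sup>2" for c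
    using norm_eq_sum_spec_proj[OF H, of b] norm_spectral_sum[OF H, of "\<lambda>_. c" b] assms(3)
      spectral_decomposition[OF H, of b]
    by (simp add: spec)
  ultimately show "norm (mat_exp (t *\<^sub>R ?A) *v b - rat_mat r ?A *v b) =
      cmod (rat_err t r (of_real z))"
    by (simp add: matrix_vector_mult_diff_rdistrib)
qed

lemma SUP_mat_error:
  fixes t :: real
  assumes poles: "rat_poles r \<inter> of_real ` {..0::real} = {}"
  shows "(SUP (A, b) \<in> {(A :: complex ^ 'n ^ 'n, b :: complex ^ 'n). neg_semidef A \<and> norm b = 1}.
           ereal (norm (mat_exp (t *\<^sub>R A) *v b - rat_mat r A *v b))) =
        (SUP z\<in>{..0::real}. ereal (cmod (rat_err t r (of_real z))))"
proof (intro antisym SUP_mono)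
  fix Ab :: "(complex ^ 'n ^ 'n) \<times> (complex ^ 'n)"
  assume "Ab \<in> {(A, b). neg_semidef A \<and> norm b = 1}"
  then obtain A b where Ab: "Ab = (A, b)" and A: "neg_semidef A" and b: "norm b = 1" by auto
  have "rat_poles r \<inter> mat_spectrum A = {}"
    using poles neg_semidef_spectrum[OF A] by blast
  moreover have "hermitian A" using A by (simp add: neg_semidef_def)
  ultimately obtain l where "l \<in> mat_spectrum A"
    "norm (mat_exp (t *\<^sub>R A) *v b - rat_mat r A *v b) \<le> cmod (rat_err t r l)"
    using mat_error_le_spectral_value b by metis
  then show "\<exists>z\<in>{..0::real}. (case Ab of (A, b) \<Rightarrow>
      ereal (norm (mat_exp (t *\<^sub>R A) *v b - rat_mat r A *v b))) \<le> ereal (cmod (rat_err t r (of_real z)))"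
    using neg_semidef_spectrum[OF A] by (auto simp: Ab)
next
  fix z :: real assume z: "z \<in> {..0}"
  have "norm (axis undefined 1 :: complex ^ 'n) = 1" by (rule norm_Basis) (simp add: axis_in_Basis_iff Basis_complex_def)
  moreover have "of_real z \<notin> rat_poles r" using poles z by blast
  ultimately show "\<exists>Ab\<in>{(A :: complex ^ 'n ^ 'n, b :: complex ^ 'n). neg_semidef A \<and> norm b = 1}.
      ereal (cmod (rat_err t r (of_real z))) \<le> (case Ab of (A, b) \<Rightarrow>
      ereal (norm (mat_exp (t *\<^sub>R A) *v b - rat_mat r A *v b)))"
    using z scalar_matrix_error[of z r "axis undefined 1 :: complex ^ 'n"]
    by (intro bexI[of _ "(mat (of_real z), axis undefined 1)"]) auto
qed

section \<open>Poles in the approximation class\<close>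

lemma rat_den_Fract_dvd:
  assumes "Q \<noteq> 0"
  shows "rat_den (Fract P Q) dvd Q"
proof -
  let ?r = "Fract P Q"
  have "Fract (rat_num ?r) (rat_den ?r) = Fract P Q"
    by (simp add: rat_num_def rat_den_def)
  then have "rat_num ?r * Q = P * rat_den ?r"
    using assms by (simp add: eq_fract rat_den_def)
  then have "rat_den ?r dvd rat_num ?r * Q" by simp
  moreover have "coprime (rat_den ?r) (rat_num ?r)"
    unfolding rat_num_def rat_den_def by (metis coprime_quot_of_fract coprime_commute)
  ultimately show ?thesis by (simp add: coprime_dvd_mult_right_iff)
qed

text \<open>
  The reduced denominator divides \<open>(q - z)\<^sup>m\<close>, so \<open>q\<close> is the only possible pole.
\<close>

lemma rat_class_poles:
  assumes "r \<in> rat_class m q" "q > 0"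
  shows "rat_poles r \<inter> of_real ` {..0::real} = {}"
proof -
  obtain P where r: "r = Fract P ([:of_real q, -1:] ^ m)"
    using assms(1) by (auto simp: rat_class_def)
  have "rat_den r dvd [:of_real q, -1:] ^ m"
    unfolding r by (rule rat_den_Fract_dvd) simp
  then obtain S where S: "[:of_real q, -1:] ^ m = rat_den r * S" by (elim dvdE)
  have "z = of_real q" if "z \<in> rat_poles r" for z
  proof -
    have "(of_real q - z) ^ m = poly (rat_den r) z * poly S z"
      using arg_cong[OF S, of "\<lambda>p. poly p z"] by (simp add: poly_power)
    then have "(of_real q - z) ^ m = 0"
      using that by (simp add: rat_poles_def)
    then show ?thesis by simp
  qed
  then have "of_real x \<notin> rat_poles r" if "x \<le> 0" for x
    using that assms(2) by (metis not_less of_real_eq_iff)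
  then show ?thesis by blast
qed

theorem proposition7p1:
  fixes t :: real
  assumes "t > 0"
  shows
    "(\<forall>r. rat_poles r \<inter> of_real ` {..0::real} = {} \<longrightarrow>
        (\<forall>(A :: complex ^ 'n ^ 'n) (b :: complex ^ 'n). neg_semidef A \<longrightarrow>
           set_integrable (spec_measure A b) (mat_spectrum A) (\<lambda>l. (cmod (rat_err t r l))\<^sup>2) \<and>
           (norm (mat_exp (t *\<^sub>R A) *v b - rat_mat r A *v b))\<^sup>2 =
             (LINT l:mat_spectrum A|spec_measure A b. (cmod (rat_err t r l))\<^sup>2)) \<and>
        (SUP (A, b) \<in> {(A :: complex ^ 'n ^ 'n, b :: complex ^ 'n). neg_semidef A \<and> norm b = 1}.
           ereal (norm (mat_exp (t *\<^sub>R A) *v b - rat_mat r A *v b))) =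
        (SUP z\<in>{..0::real}. ereal (cmod (rat_err t r (of_real z))))) \<and>
     (\<forall>q m. q > 0 \<longrightarrow>
        (INF r\<in>rat_class m q.
           SUP (A, b) \<in> {(A :: complex ^ 'n ^ 'n, b :: complex ^ 'n). neg_semidef A \<and> norm b = 1}.
             ereal (norm (mat_exp (t *\<^sub>R A) *v b - rat_mat r A *v b))) =
        best_rat_err m t q)"
proof (intro conjI allI impI)
  fix r and A :: "complex ^ 'n ^ 'n" and b :: "complex ^ 'n"
  assume poles: "rat_poles r \<inter> of_real ` {..0::real} = {}" and A: "neg_semidef A"
  have H: "hermitian A" using A by (simp add: neg_semidef_def)
  show "set_integrable (spec_measure A b) (mat_spectrum A) (\<lambda>l. (cmod (rat_err t r l))\<^sup>2)"
    by (rule integral_spec_measure(1)[OF H])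
  have "rat_poles r \<inter> mat_spectrum A = {}"
    using poles neg_semidef_spectrum[OF A] by blast
  then show "(norm (mat_exp (t *\<^sub>R A) *v b - rat_mat r A *v b))\<^sup>2 =
      (LINT l:mat_spectrum A|spec_measure A b. (cmod (rat_err t r l))\<^sup>2)"
    by (simp only: mat_error_norm[OF H] integral_spec_measure(2)[OF H])
next
  fix r assume "rat_poles r \<inter> of_real ` {..0::real} = {}"
  then show "(SUP (A, b) \<in> {(A :: complex ^ 'n ^ 'n, b :: complex ^ 'n). neg_semidef A \<and> norm b = 1}.
           ereal (norm (mat_exp (t *\<^sub>R A) *v b - rat_mat r A *v b))) =
        (SUP z\<in>{..0::real}. ereal (cmod (rat_err t r (of_real z))))"
    by (rule SUP_mat_error)
next
  fix q :: real and m :: nat assume "q > 0"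
  then show "(INF r\<in>rat_class m q.
           SUP (A, b) \<in> {(A :: complex ^ 'n ^ 'n, b :: complex ^ 'n). neg_semidef A \<and> norm b = 1}.
             ereal (norm (mat_exp (t *\<^sub>R A) *v b - rat_mat r A *v b))) = best_rat_err m t q"
    unfolding best_rat_err_def by (intro INF_cong refl SUP_mat_error rat_class_poles)
qed

end
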